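(* Let $G$ be a finite simple undirected graph with at least one vertex. Then $$D(G\,\square\, K_2,x)=\frac{x^{|V(G)|}}{x+1}\sum_{W\subseteq V(G)}\frac{D(J_W/z,x)+D(J_W-N_{J_W}[z],x)+D(J_W,x)-D(J_W-z,x)}{x^{|N_G(W)|}},$$ where, for each $W\subseteq V(G)$, $J_W$ is the graph obtained from the subgraph of $G$ induced by $N_G[W]$ by adding one new vertex $z$ and joining $z$ to every vertex of $W\cup N_G\bigl(V(G)\setminus N_G[W]\bigr)$.
   Context: All graphs are finite, simple and undirected. A set $S\subseteq V(G)$ is dominating in $G$ if every vertex of $G$ is in $S$ or adjacent to a vertex of $S$. The domination polynomial is $D(G,x)=\sum_{i=0}^{|V(G)|} d_i(G)x^i$, where $d_i(G)$ is the number of dominating sets of $G$ of size $i$; in particular the null graph (no vertices) has domination polynomial $1$. For $W\subseteq V(G)$, $N_G[W]$ (closed neighbourhood) is the set consisting of $W$ and all vertices adjacent to a vertex of $W$, and $N_G(W)=N_G[W]\setminus W$ is the open neighbourhood; $N_G[v]=N_G[\{v\}]$. For a set $S$ of vertices, $G-S$ is the graph obtained by deleting all vertices of $S$, and $G-v=G-\{v\}$. The vertex contraction $G/v$ is the graph obtained from $G$ by removing $v$ and adding an edge between every pair of non-adjacent neighbours of $v$. The Cartesian product $G\,\square\, H$ has vertex set $V(G)\times V(H)$, with $(u_1,v_1)$ and $(u_2,v_2)$ adjacent iff either $u_1=u_2$ and $v_1v_2\in E(H)$, or $u_1u_2\in E(G)$ and $v_1=v_2$. $K_r$ is the complete graph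 on $r$ vertices. *)

theory Defs
  imports
    "Graph_Theory.Graph_Theory"
    "HOL-Computational_Algebra.Polynomial_Factorial"
begin

text \<open>
  Finite simple undirected graphs are those satisfying \<^locale>\<open>graph\<close>: finite symmetric digraphs
  without loops or parallel arcs, the null graph being allowed. Adjacency of \<open>u\<close> and \<open>v\<close> is
  \<open>u \<rightarrow>\<^bsub>G\<^esub> v\<close>, and an undirected edge corresponds to a pair of opposite arcs. The graph
  constructions below depend on their arguments only through vertices and adjacency; where they
  introduce new arcs, these are the pairs of their endpoints.
\<close>

definition dominating_set :: "('a,'b) pre_digraph \<Rightarrow> 'a set \<Rightarrow> bool" where
  "dominating_set G S \<longleftrightarrow>
     S \<subseteq> verts G \<and> (\<forall>v\<in>verts G. v \<in> S \<or> (\<exists>u\<in>S. u \<rightarrow>\<^bsub>G\<^esub> v))"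

definition num_dominating_sets :: "('a,'b) pre_digraph \<Rightarrow> nat \<Rightarrow> nat" where
  "num_dominating_sets G i = card {S. dominating_set G S \<and> card S = i}"

definition domination_poly :: "('a,'b) pre_digraph \<Rightarrow> int poly" where
  "domination_poly G = (\<Sum>i\<le>card (verts G). monom (int (num_dominating_sets G i)) i)"

definition closed_nbhd :: "('a,'b) pre_digraph \<Rightarrow> 'a set \<Rightarrow> 'a set" where
  "closed_nbhd G W = W \<union> {v. \<exists>w\<in>W. w \<rightarrow>\<^bsub>G\<^esub> v}"

definition open_nbhd :: "('a,'b) pre_digraph \<Rightarrow> 'a set \<Rightarrow> 'a set" where
  "open_nbhd G W = closed_nbhd G W - W"

definition delete_verts :: "('a,'b) pre_digraph \<Rightarrow> 'a set \<Rightarrow> ('a,'b) pre_digraph" where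
  "delete_verts G S = G \<restriction> (verts G - S)"

definition contract_vert :: "('a,'b) pre_digraph \<Rightarrow> 'a \<Rightarrow> ('a, 'a \<times> 'a) pre_digraph" where
  "contract_vert G v = with_proj
     \<lparr> pverts = verts G - {v},
       parcs = arcs_ends (delete_verts G {v})
         \<union> {(a, b). a \<in> open_nbhd G {v} \<and> b \<in> open_nbhd G {v} \<and> a \<noteq> b} \<rparr>"

definition cartesian_product ::
  "('a,'b) pre_digraph \<Rightarrow> ('c,'d) pre_digraph \<Rightarrow> ('a \<times> 'c, ('a \<times> 'c) \<times> ('a \<times> 'c)) pre_digraph"
where
  "cartesian_product G H = with_proj
     \<lparr> pverts = verts G \<times> verts H,
       parcs = {((u1, v1), (u2, v2)).
         (u1, v1) \<in> verts G \<times> verts H \<and> (u2, v2) \<in> verts G \<times> verts H \<and>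
         (u1 = u2 \<and> v1 \<rightarrow>\<^bsub>H\<^esub> v2 \<or> u1 \<rightarrow>\<^bsub>G\<^esub> u2 \<and> v1 = v2)} \<rparr>"

text \<open>
  The graph $J_W$. The new vertex $z$ is \<^term>\<open>None\<close>, and a vertex \<open>v\<close> of \<open>G\<close> becomes \<open>Some v\<close>.
\<close>

definition J_graph ::
  "('a,'b) pre_digraph \<Rightarrow> 'a set \<Rightarrow> ('a option, 'a option \<times> 'a option) pre_digraph"
where
  "J_graph G W =
     (let A = W \<union> open_nbhd G (verts G - closed_nbhd G W) in
      with_proj
       \<lparr> pverts = insert None (Some ` closed_nbhd G W),
         parcs = map_prod Some Some ` arcs_ends (G \<restriction> closed_nbhd G W)
           \<union> {(None, Some v) |v. v \<in> A} \<union> {(Some v, None) |v. v \<in> A} \<rparr>)"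

text \<open>
  Since the identity involves division by $x + 1$ and by powers of $x$, it is stated in the field
  of rational functions, as an identity of formal expressions.
\<close>

definition ratfun_X :: "int poly fract" where
  "ratfun_X = to_fract [:0, 1:]"

definition domination_ratfun :: "('a,'b) pre_digraph \<Rightarrow> int poly fract" where
  "domination_ratfun G = to_fract (domination_poly G)"

end

theory Submission
  imports Defs
begin

text \<open>
  A set of vertices of the prism \<open>G \<box> K\<^sub>2\<close> is a pair \<open>(W, S)\<close> of subsets of \<open>V = V(G)\<close>, one per layer;
  it is dominating iff \<open>V = N[W] \<union> S\<close> and \<open>V = N[S] \<union> W\<close>
  (\<open>domination_ratfun_prism\<close>). Fix \<open>W\<close>. The first condition says that \<open>S\<close> contains
  \<open>B = V - N[W]\<close>, so \<open>S = B \<union> T\<close> with \<open>T \<subseteq> N[W]\<close> arbitrary. In the second condition, the vertices of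
  \<open>B\<close> are dominated by themselves, and in \<open>N[W]\<close> exactly the vertices of \<open>A = W \<union> N(B)\<close> are taken
  care of without the help of \<open>T\<close>; hence \<open>T\<close> has to dominate \<open>N[W] - A\<close> and nothing else. As \<open>V\<close> is
  the disjoint union of \<open>W\<close>, \<open>B\<close> and \<open>N(W)\<close>, the sets \<open>S\<close> contribute
  \<open>x\<^bsup>|V| - |N(W)|\<^esup> Q\<^sub>W\<close>, where \<open>Q\<^sub>W\<close> enumerates these sets \<open>T\<close> by size
  (\<open>size_enum_second_layer\<close>).

  The vertex \<open>z\<close> encodes the exempted set: its neighbours in \<open>J\<^sub>W\<close> are exactly the vertices of \<open>A\<close>.
  So it remains to count, in any graph \<open>J\<close> with a vertex \<open>z\<close>, the sets avoiding \<open>z\<close> that dominate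
  every vertex outside \<open>N[z]\<close>. Sorting them by whether they meet \<open>N(z)\<close> expresses \<open>(x + 1) Q\<close>
  through the domination polynomials of \<open>J/z\<close>, \<open>J - N[z]\<close>, \<open>J\<close> and \<open>J - z\<close>
  (\<open>size_enum_dominating_far_verts\<close>); dividing by \<open>x + 1\<close> and summing over \<open>W\<close> gives the theorem.
\<close>

section \<open>Enumerating sets of vertices by size\<close>

text \<open>
  All polynomials here count families of vertex sets by size. Enumerating the families directly in
  the field of rational functions turns their decompositions into sums and products there.
\<close>

definition size_enum :: "'a set set \<Rightarrow> int poly fract" where
  "size_enum F = (\<Sum>S\<in>F. ratfun_X ^ card S)"

lemma size_enum_Un_disjoint:
  assumes "finite F" "finite F'" "F \<inter> F' = {}"
  shows "size_enum (F \<union> F') = size_enum F + size_enum F'"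
  using assms by (simp add: size_enum_def sum.union_disjoint)

lemma size_enum_insert_elem:
  assumes "\<And>S. S \<in> F \<Longrightarrow> finite S \<and> z \<notin> S"
  shows "size_enum (insert z ` F) = ratfun_X * size_enum F"
proof -
  have "inj_on (insert z) F"
    using assms by (intro inj_onI) (metis Diff_insert_absorb)
  then show ?thesis
    using assms by (simp add: size_enum_def sum.reindex sum_distrib_left)
qed

lemma dominating_set_iff:
  "dominating_set G S \<longleftrightarrow> S \<subseteq> verts G \<and> verts G \<subseteq> closed_nbhd G S"
  by (auto simp: dominating_set_def closed_nbhd_def)

lemma to_fract_power: "to_fract (p ^ n) = to_fract p ^ n"
  by (induction n) auto

lemma domination_ratfun_eq_size_enum:
  assumes "finite (verts G)"
  shows "domination_ratfun G = size_enum {S. S \<subseteq> verts G \<and> verts G \<subseteq> closed_nbhd G S}"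
proof -
  let ?D = "{S. dominating_set G S}"
  have fin: "finite ?D"
    by (rule finite_subset[of _ "Pow (verts G)"]) (use assms in \<open>auto simp: dominating_set_def\<close>)
  have card: "card ` ?D \<subseteq> {..card (verts G)}"
    using assms by (auto simp: dominating_set_def card_mono)
  have monom: "monom 1 i = [:0, 1::int:] ^ i" for i
    by (simp add: monom_altdef)
  have "domination_poly G
      = (\<Sum>i\<le>card (verts G). \<Sum>S\<in>{S \<in> ?D. card S = i}. monom 1 (card S))"
    unfolding domination_poly_def num_dominating_sets_def
    by (intro sum.cong) (auto simp: of_nat_monom mult_monom)
  also have "\<dots> = (\<Sum>S\<in>?D. monom 1 (card S))"
    using sum.group[OF fin _ card, of "\<lambda>S. monom 1 (card S) :: int poly"] by simp
  finally show ?thesis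
    by (simp add: domination_ratfun_def size_enum_def ratfun_X_def monom to_fract_power
        dominating_set_iff)
qed

section \<open>Sets dominating all vertices far from a given vertex\<close>

lemma dominates_delete_verts:
  "u \<rightarrow>\<^bsub>delete_verts G S\<^esub> v \<longleftrightarrow> u \<rightarrow>\<^bsub>G\<^esub> v \<and> u \<in> verts G - S \<and> v \<in> verts G - S"
  by (auto simp: delete_verts_def arcs_ends_conv)

lemma verts_delete_verts [simp]: "verts (delete_verts G S) = verts G - S"
  by (simp add: delete_verts_def)

lemma verts_contract_vert [simp]: "verts (contract_vert G v) = verts G - {v}"
  by (simp add: contract_vert_def)

lemma dominates_contract_vert:
  "a \<rightarrow>\<^bsub>contract_vert G v\<^esub> b \<longleftrightarrow> a \<rightarrow>\<^bsub>delete_verts G {v}\<^esub> b \<or>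
     a \<in> open_nbhd G {v} \<and> b \<in> open_nbhd G {v} \<and> a \<noteq> b"
  by (simp add: contract_vert_def)

text \<open>
  Let \<open>H = V(J) - z\<close> and \<open>N = N(z)\<close>, and let a subset of \<open>H\<close> be of type \<open>P\<close> if it dominates \<open>H - N\<close>
  and of type \<open>E\<close> if it dominates all of \<open>H\<close>, with index 1 if it meets \<open>N\<close> and 0 if not. Writing
  these symbols also for the enumerators, the wanted \<open>Q\<close> is \<open>P\<^sub>0 + P\<^sub>1\<close>, and

    \<^item> \<open>D(J - z) = E\<^sub>0 + E\<^sub>1\<close>;

    \<^item> \<open>D(J - N[z]) = P\<^sub>0\<close>, its vertex set being \<open>H - N\<close>;

    \<^item> \<open>D(J/z) = P\<^sub>1 + E\<^sub>0\<close>, because \<open>N\<close> is a clique of \<open>J/z\<close>: one chosen vertex in \<open>N\<close> dominates all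
      of \<open>N\<close>, whereas without one the added edges are of no use;

    \<^item> \<open>D(J) = x (P\<^sub>0 + P\<^sub>1) + E\<^sub>1\<close>: a dominating set containing \<open>z\<close> gets \<open>N\<close> for free, and one without
      \<open>z\<close> must meet \<open>N\<close> in order to dominate \<open>z\<close>.

  In \<open>D(J/z) + D(J - N[z]) + D(J) - D(J - z)\<close> all terms \<open>E\<close> cancel and \<open>(x + 1) (P\<^sub>0 + P\<^sub>1)\<close> is left.
\<close>

lemma size_enum_dominating_far_verts:
  assumes "pseudo_graph J" and z: "z \<in> verts J"
  shows "(ratfun_X + 1) *
      size_enum {T. T \<subseteq> verts J - {z} \<and> verts J - closed_nbhd J {z} \<subseteq> closed_nbhd J T} =
    domination_ratfun (contract_vert J z)
    + domination_ratfun (delete_verts J (closed_nbhd J {z}))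
    + domination_ratfun J
    - domination_ratfun (delete_verts J {z})"
proof -
  interpret pseudo_graph J by fact
  have sym: "v \<rightarrow>\<^bsub>J\<^esub> u" if "u \<rightarrow>\<^bsub>J\<^esub> v" for u v
    using arcs_ends_symmetric[OF sym_arcs that] .
  define N where "N = open_nbhd J {z}"
  define H where "H = verts J - {z}"
  have N_iff: "v \<in> N \<longleftrightarrow> v \<noteq> z \<and> z \<rightarrow>\<^bsub>J\<^esub> v" for v
    by (auto simp: N_def open_nbhd_def closed_nbhd_def)
  have closed_z: "closed_nbhd J {z} = insert z N"
    by (auto simp: N_iff closed_nbhd_def)
  have NH: "N \<subseteq> H"
    using adj_in_verts by (auto simp: N_iff H_def)
  have far: "verts J - closed_nbhd J {z} = H - N"
    by (auto simp: closed_z H_def)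
  define P0 where "P0 = {T. T \<subseteq> H \<and> T \<inter> N = {} \<and> H - N \<subseteq> closed_nbhd J T}"
  define P1 where "P1 = {T. T \<subseteq> H \<and> T \<inter> N \<noteq> {} \<and> H - N \<subseteq> closed_nbhd J T}"
  define E0 where "E0 = {T. T \<subseteq> H \<and> T \<inter> N = {} \<and> H \<subseteq> closed_nbhd J T}"
  define E1 where "E1 = {T. T \<subseteq> H \<and> T \<inter> N \<noteq> {} \<and> H \<subseteq> closed_nbhd J T}"
  have finH: "finite H"
    by (simp add: H_def)
  have fin: "finite P0" "finite P1" "finite E0" "finite E1"
    by (rule finite_subset[of _ "Pow H"]; force simp: finH P0_def P1_def E0_def E1_def)+
  have Q: "{T. T \<subseteq> verts J - {z} \<and> verts J - closed_nbhd J {z} \<subseteq> closed_nbhd J T} = P0 \<union> P1"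
    unfolding far P0_def P1_def by (auto simp: H_def)
  have disj: "P0 \<inter> P1 = {}" "P1 \<inter> E0 = {}" "E0 \<inter> E1 = {}"
    by (auto simp: P0_def P1_def E0_def E1_def)
  have del: "domination_ratfun (delete_verts J {z}) = size_enum E0 + size_enum E1"
  proof -
    have "H \<subseteq> closed_nbhd (delete_verts J {z}) T \<longleftrightarrow> H \<subseteq> closed_nbhd J T" if "T \<subseteq> H" for T
      using that by (auto simp: closed_nbhd_def dominates_delete_verts H_def subset_iff)
    then have "{S. S \<subseteq> H \<and> H \<subseteq> closed_nbhd (delete_verts J {z}) S} = E0 \<union> E1"
      by (auto simp: E0_def E1_def)
    then show ?thesis
      using fin disj by (simp add: domination_ratfun_eq_size_enum size_enum_Un_disjoint finH
          flip: H_def)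
  qed
  have far_del: "domination_ratfun (delete_verts J (closed_nbhd J {z})) = size_enum P0"
  proof -
    have "H - N \<subseteq> closed_nbhd (delete_verts J (closed_nbhd J {z})) T
        \<longleftrightarrow> H - N \<subseteq> closed_nbhd J T" if "T \<subseteq> H - N" for T
      using that by (auto simp: closed_nbhd_def[of _ T] dominates_delete_verts far subset_iff)
    then have "{S. S \<subseteq> H - N \<and> H - N \<subseteq> closed_nbhd (delete_verts J (closed_nbhd J {z})) S} = P0"
      by (auto simp: P0_def)
    then show ?thesis
      by (simp add: domination_ratfun_eq_size_enum far finH)
  qed
  have contract: "domination_ratfun (contract_vert J z) = size_enum P1 + size_enum E0"
  proof -
    have adj: "u \<rightarrow>\<^bsub>contract_vert J z\<^esub> v \<longleftrightarrow> u \<rightarrow>\<^bsub>J\<^esub> v \<or> u \<in> N \<and> v \<in> N \<and> u \<noteq> v"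
      if "u \<in> H" "v \<in> H" for u v
      using that by (auto simp: dominates_contract_vert dominates_delete_verts N_def H_def)
    have meet: "H \<subseteq> closed_nbhd (contract_vert J z) T \<longleftrightarrow> H - N \<subseteq> closed_nbhd J T"
      if T: "T \<subseteq> H" "T \<inter> N \<noteq> {}" for T
    proof -
      have "v \<in> closed_nbhd (contract_vert J z) T \<longleftrightarrow> v \<in> N \<or> v \<in> closed_nbhd J T"
        if "v \<in> H" for v
        using that T adj by (fastforce simp: closed_nbhd_def)
      then show ?thesis by blast
    qed
    have avoid: "H \<subseteq> closed_nbhd (contract_vert J z) T \<longleftrightarrow> H \<subseteq> closed_nbhd J T"
      if T: "T \<subseteq> H" "T \<inter> N = {}" for T
    proof -
      have "u \<rightarrow>\<^bsub>contract_vert J z\<^esub> v \<longleftrightarrow> u \<rightarrow>\<^bsub>J\<^esub> v" if "u \<in> T" "v \<in> H" for u v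
        using that T adj by blast
      then show ?thesis
        unfolding closed_nbhd_def by blast
    qed
    have "{S. S \<subseteq> H \<and> H \<subseteq> closed_nbhd (contract_vert J z) S} = P1 \<union> E0"
    proof (rule set_eqI)
      fix S
      show "S \<in> {S. S \<subseteq> H \<and> H \<subseteq> closed_nbhd (contract_vert J z) S} \<longleftrightarrow> S \<in> P1 \<union> E0"
        using meet[of S] avoid[of S] by (cases "S \<subseteq> H"; cases "S \<inter> N = {}") (simp_all add: P1_def E0_def)
    qed
    then show ?thesis
      using fin disj by (simp add: domination_ratfun_eq_size_enum size_enum_Un_disjoint finH
          flip: H_def)
  qed
  have whole: "domination_ratfun J = ratfun_X * (size_enum P0 + size_enum P1) + size_enum E1"
  proof -
    have V: "verts J = insert z H"
      using z by (auto simp: H_def)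
    have with_z: "insert z H \<subseteq> closed_nbhd J (insert z T) \<longleftrightarrow> H - N \<subseteq> closed_nbhd J T"
      if "T \<subseteq> H" for T
      using that by (auto simp: closed_nbhd_def N_iff H_def)
    have without_z: "insert z H \<subseteq> closed_nbhd J T \<longleftrightarrow> H \<subseteq> closed_nbhd J T \<and> T \<inter> N \<noteq> {}"
      if "T \<subseteq> H" for T
    proof -
      have "z \<notin> T" using that by (auto simp: H_def)
      moreover from this have "u \<rightarrow>\<^bsub>J\<^esub> z \<longleftrightarrow> u \<in> N" if "u \<in> T" for u
        using sym[of u z] sym[of z u] that by (auto simp: N_iff)
      ultimately have "z \<in> closed_nbhd J T \<longleftrightarrow> T \<inter> N \<noteq> {}"
        by (auto simp: closed_nbhd_def)
      then show ?thesis by auto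
    qed
    have "{S. S \<subseteq> verts J \<and> verts J \<subseteq> closed_nbhd J S} = insert z ` (P0 \<union> P1) \<union> E1"
      (is "?L = ?R")
    proof (intro equalityI subsetI)
      fix S assume S: "S \<in> ?L"
      show "S \<in> ?R"
      proof (cases "z \<in> S")
        case True
        then have "S = insert z (S - {z})" "S - {z} \<subseteq> H"
          using S V by auto
        moreover from this have "S - {z} \<in> P0 \<union> P1"
          using S with_z[of "S - {z}"] unfolding V P0_def P1_def by auto
        ultimately show ?thesis by blast
      next
        case False
        then have "S \<subseteq> H" using S V by auto
        then show ?thesis
          using S without_z[of S] unfolding V E1_def by simp
      qed
    next
      fix S assume "S \<in> ?R"
      then consider T where "S = insert z T" "T \<subseteq> H" "H - N \<subseteq> closed_nbhd J T"
        | "S \<subseteq> H" "S \<inter> N \<noteq> {}" "H \<subseteq> closed_nbhd J S"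
        unfolding P0_def P1_def E1_def by blast
      then show "S \<in> ?L"
      proof cases
        case 1
        then show ?thesis using with_z[of T] unfolding V by auto
      next
        case 2
        then show ?thesis using without_z[of S] unfolding V by auto
      qed
    qed
    moreover have "insert z ` (P0 \<union> P1) \<inter> E1 = {}"
      by (auto simp: E1_def H_def)
    moreover have "size_enum (insert z ` (P0 \<union> P1)) = ratfun_X * size_enum (P0 \<union> P1)"
      using finite_subset[OF _ finH]
      by (intro size_enum_insert_elem) (auto simp: P0_def P1_def H_def)
    ultimately show ?thesis
      using fin disj by (simp add: domination_ratfun_eq_size_enum size_enum_Un_disjoint)
  qed
  show ?thesis
    unfolding Q del far_del contract whole
    using fin disj by (simp add: size_enum_Un_disjoint algebra_simps)
qed

section \<open>Dominating sets of the prism, layer by layer\<close>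

text \<open>
  A vertex of one layer has a single neighbour outside its layer, namely its copy in the other one.
  So what a layer fails to dominate internally must be present in the other layer.
\<close>

lemma domination_ratfun_prism:
  assumes fin: "finite (verts G)" and K2: "K\<^bsub>2\<^esub> K2"
  shows "domination_ratfun (cartesian_product G K2) =
    (\<Sum>W\<in>Pow (verts G). ratfun_X ^ card W *
       size_enum {S. S \<subseteq> verts G \<and> verts G \<subseteq> closed_nbhd G W \<union> S
                                   \<and> verts G \<subseteq> closed_nbhd G S \<union> W})"
proof -
  let ?V = "verts G" and ?P = "cartesian_product G K2"
  obtain a b where ab: "a \<noteq> b" "verts K2 = {a, b}"
    using K2 by (auto simp: complete_digraph_def card_2_iff)
  have K2_adj: "u \<rightarrow>\<^bsub>K2\<^esub> v \<longleftrightarrow> u \<in> {a, b} \<and> v \<in> {a, b} \<and> u \<noteq> v" for u v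
    using K2 ab by (auto simp: complete_digraph_def)
  have V: "verts ?P = ?V \<times> {a, b}"
    by (simp add: cartesian_product_def ab)
  have adj: "(u, c) \<rightarrow>\<^bsub>?P\<^esub> (v, d) \<longleftrightarrow> u \<in> ?V \<and> v \<in> ?V \<and> c \<in> {a, b} \<and> d \<in> {a, b} \<and>
      (u = v \<and> c \<noteq> d \<or> u \<rightarrow>\<^bsub>G\<^esub> v \<and> c = d)" for u v c d
    by (auto simp: cartesian_product_def ab K2_adj)
  define F where "F W = {S. S \<subseteq> ?V \<and> ?V \<subseteq> closed_nbhd G W \<union> S \<and> ?V \<subseteq> closed_nbhd G S \<union> W}" for W
  define join where "join = (\<lambda>(W :: 'a set, S). W \<times> {a} \<union> S \<times> {b})"
  define layer where "layer c R = {u. (u, c) \<in> R}" for c and R :: "('a \<times> 'c) set"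
  have layers: "layer a (join (W, S)) = W" "layer b (join (W, S)) = S" for W S
    using ab by (auto simp: layer_def join_def)
  have dom: "?V \<times> {a, b} \<subseteq> closed_nbhd ?P (join (W, S)) \<longleftrightarrow>
      ?V \<subseteq> closed_nbhd G W \<union> S \<and> ?V \<subseteq> closed_nbhd G S \<union> W"
    if "W \<subseteq> ?V" "S \<subseteq> ?V" for W S
  proof -
    have mem: "(u, a) \<in> join (W, S) \<longleftrightarrow> u \<in> W" "(u, b) \<in> join (W, S) \<longleftrightarrow> u \<in> S" for u
      using ab by (auto simp: join_def)
    have nbhd: "(v, c) \<in> closed_nbhd ?P R \<longleftrightarrow> (v, c) \<in> R \<or>
        (\<exists>u. (u, a) \<in> R \<and> (u, a) \<rightarrow>\<^bsub>?P\<^esub> (v, c)) \<or> (\<exists>u. (u, b) \<in> R \<and> (u, b) \<rightarrow>\<^bsub>?P\<^esub> (v, c))"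
      for v c R
      unfolding closed_nbhd_def using adj by (auto 4 3)
    have "(v, a) \<in> closed_nbhd ?P (join (W, S)) \<longleftrightarrow> v \<in> closed_nbhd G W \<union> S"
      "(v, b) \<in> closed_nbhd ?P (join (W, S)) \<longleftrightarrow> v \<in> closed_nbhd G S \<union> W" if "v \<in> ?V" for v
      using that ab \<open>W \<subseteq> ?V\<close> \<open>S \<subseteq> ?V\<close> unfolding nbhd mem adj
      by (auto simp: closed_nbhd_def)
    then show ?thesis by auto
  qed
  have "domination_ratfun ?P
      = (\<Sum>R\<in>{R. R \<subseteq> ?V \<times> {a, b} \<and> ?V \<times> {a, b} \<subseteq> closed_nbhd ?P R}. ratfun_X ^ card R)"
    using fin by (simp add: domination_ratfun_eq_size_enum size_enum_def V)
  also have "\<dots> = (\<Sum>(W, S)\<in>Sigma (Pow ?V) F. ratfun_X ^ (card W + card S))"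
  proof (rule sum.reindex_bij_witness[where i = join and j = "\<lambda>R. (layer a R, layer b R)"])
    fix R assume R: "R \<in> {R. R \<subseteq> ?V \<times> {a, b} \<and> ?V \<times> {a, b} \<subseteq> closed_nbhd ?P R}"
    show join: "join (layer a R, layer b R) = R"
      using R by (auto simp: join_def layer_def)
    have sub: "layer a R \<subseteq> ?V" "layer b R \<subseteq> ?V"
      using R by (auto simp: layer_def)
    show "(layer a R, layer b R) \<in> Sigma (Pow ?V) F"
      using R dom[OF sub] sub unfolding join F_def by auto
    have "card R = card (layer a R \<times> {a} \<union> layer b R \<times> {b})"
      using join by (simp add: join_def)
    also have "\<dots> = card (layer a R) + card (layer b R)"
      using ab sub[THEN finite_subset[OF _ fin]]
      by (subst card_Un_disjoint) (auto simp: card_cartesian_product)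
    finally show "(case (layer a R, layer b R) of (W, S) \<Rightarrow> ratfun_X ^ (card W + card S))
        = ratfun_X ^ card R"
      by simp
  next
    fix p assume "p \<in> Sigma (Pow ?V) F"
    then obtain W S where p: "p = (W, S)" "W \<subseteq> ?V" "S \<in> F W" by auto
    then show "(layer a (join p), layer b (join p)) = p"
      by (simp add: layers)
    show "join p \<in> {R. R \<subseteq> ?V \<times> {a, b} \<and> ?V \<times> {a, b} \<subseteq> closed_nbhd ?P R}"
      using p dom[of W S] by (auto simp: F_def) (auto simp: join_def)
  qed
  also have "\<dots> = (\<Sum>W\<in>Pow ?V. \<Sum>S\<in>F W. ratfun_X ^ (card W + card S))"
  proof -
    have "finite (F W)" for W
      by (rule finite_subset[of _ "Pow ?V"]) (auto simp: F_def fin)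
    then show ?thesis
      using fin by (subst sum.Sigma) auto
  qed
  finally show ?thesis
    by (simp add: size_enum_def F_def power_add sum_distrib_left)
qed

section \<open>The graph J and the choices for the second layer\<close>

lemma closed_nbhd_Un: "closed_nbhd G (A \<union> B) = closed_nbhd G A \<union> closed_nbhd G B"
  by (auto simp: closed_nbhd_def)

lemma (in wf_digraph) closed_nbhd_subset_verts:
  "W \<subseteq> verts G \<Longrightarrow> closed_nbhd G W \<subseteq> verts G"
  using adj_in_verts by (auto simp: closed_nbhd_def)

context
  fixes G :: "('a, 'b) pre_digraph" and W
  assumes G: "graph G" and W: "W \<subseteq> verts G"
begin

interpretation graph G by (rule G)

abbreviation (input) "hood \<equiv> closed_nbhd G W"
abbreviation (input) "joined \<equiv> W \<union> open_nbhd G (verts G - closed_nbhd G W)"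

lemma verts_J_graph: "verts (J_graph G W) = insert None (Some ` hood)"
  by (simp add: J_graph_def)

text \<open>
  A vertex adjacent to, but not in, the complement of \<open>N[W]\<close> lies in \<open>N[W]\<close>. This makes the new arcs
  of \<open>J\<^sub>W\<close> end in vertices of \<open>J\<^sub>W\<close>.
\<close>

lemma joined_to_z_subset: "joined \<subseteq> hood"
  using adj_in_verts by (auto simp: open_nbhd_def closed_nbhd_def)

lemma dominates_J_graph:
  "Some u \<rightarrow>\<^bsub>J_graph G W\<^esub> Some v \<longleftrightarrow> u \<in> hood \<and> v \<in> hood \<and> u \<rightarrow>\<^bsub>G\<^esub> v"
  "None \<rightarrow>\<^bsub>J_graph G W\<^esub> Some v \<longleftrightarrow> v \<in> joined"
  "Some v \<rightarrow>\<^bsub>J_graph G W\<^esub> None \<longleftrightarrow> v \<in> joined"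
  "\<not> None \<rightarrow>\<^bsub>J_graph G W\<^esub> None"
  by (auto simp: J_graph_def Let_def image_iff) (auto simp: arcs_ends_conv)

lemma pseudo_graph_J_graph: "pseudo_graph (J_graph G W)"
proof -
  let ?J = "J_graph G W"
  have fin: "finite (verts ?J)"
    using finite_subset[OF closed_nbhd_subset_verts[OF W]] by (simp add: verts_J_graph)
  have arcs: "arcs ?J = arcs_ends ?J" and ends: "tail ?J = fst" "head ?J = snd"
    by (simp_all add: J_graph_def Let_def)
  have sub: "x \<in> verts ?J \<and> y \<in> verts ?J" and sym: "y \<rightarrow>\<^bsub>?J\<^esub> x" if "x \<rightarrow>\<^bsub>?J\<^esub> y" for x y
    using that joined_to_z_subset arcs_ends_symmetric[OF sym_arcs]
    by (cases x; cases y; auto simp: dominates_J_graph verts_J_graph)+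
  have "finite (arcs_ends ?J)"
    by (rule finite_subset[of _ "verts ?J \<times> verts ?J"]) (use sub fin in auto)
  then show ?thesis
    using fin sub sym
    by unfold_locales (auto simp: arcs ends symmetric_def intro: symI)
qed

text \<open>
  The admissible second layers are the sets \<open>B \<union> T\<close>, where \<open>B\<close> is the complement of \<open>N[W]\<close> and
  \<open>T \<subseteq> N[W]\<close> dominates the vertices of \<open>N[W]\<close> that are neither in \<open>W\<close> nor adjacent to \<open>B\<close>. In
  \<open>J\<^sub>W\<close> these are the vertices outside \<open>N[z]\<close>, and since the edges of \<open>J\<^sub>W\<close> away from \<open>z\<close> are those
  of \<open>G\<close>, the sets \<open>T\<close> are those of \<open>size_enum_dominating_far_verts\<close>. The powers of \<open>x\<close> come from
  \<open>|W| + |B| = |V| - |N(W)|\<close>.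
\<close>

lemma size_enum_second_layer:
  "ratfun_X ^ card W *
     size_enum {S. S \<subseteq> verts G \<and> verts G \<subseteq> hood \<union> S \<and> verts G \<subseteq> closed_nbhd G S \<union> W} =
   ratfun_X ^ card (verts G) / ratfun_X ^ card (open_nbhd G W) *
     size_enum {T. T \<subseteq> verts (J_graph G W) - {None} \<and>
       verts (J_graph G W) - closed_nbhd (J_graph G W) {None} \<subseteq> closed_nbhd (J_graph G W) T}"
proof -
  let ?V = "verts G" and ?J = "J_graph G W"
  define B where "B = ?V - hood"
  define Q where "Q = {T. T \<subseteq> hood \<and> hood - joined \<subseteq> closed_nbhd G T}"
  have CV: "hood \<subseteq> ?V" by (rule closed_nbhd_subset_verts[OF W])
  have WC: "W \<subseteq> hood" by (auto simp: closed_nbhd_def)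
  have fin: "finite hood" "finite W" "finite B"
    using finite_subset[OF CV] finite_subset[OF W] by (auto simp: B_def)
  have NB: "closed_nbhd G B \<union> W = B \<union> joined"
    by (auto simp: B_def open_nbhd_def closed_nbhd_def)
  \<comment> \<open>Splitting off the forced part \<open>B\<close>; by \<open>NB\<close> it leaves exactly \<open>hood - joined\<close> to \<open>T\<close>.\<close>
  have "{S. S \<subseteq> ?V \<and> ?V \<subseteq> hood \<union> S \<and> ?V \<subseteq> closed_nbhd G S \<union> W} = (\<union>) B ` Q" (is "?L = ?R")
  proof (intro equalityI subsetI)
    fix S assume S: "S \<in> ?L"
    then have eq: "S = B \<union> (S \<inter> hood)" by (auto simp: B_def)
    have "?V \<subseteq> closed_nbhd G (B \<union> (S \<inter> hood)) \<union> W"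
      using S eq by auto
    then have "S \<inter> hood \<in> Q"
      using NB CV unfolding closed_nbhd_Un Q_def B_def by blast
    then show "S \<in> ?R" using eq by blast
  next
    fix S assume "S \<in> ?R"
    then obtain T where T: "S = B \<union> T" "T \<subseteq> hood" "hood - joined \<subseteq> closed_nbhd G T"
      by (auto simp: Q_def)
    then have "?V \<subseteq> closed_nbhd G S \<union> W"
      using NB unfolding T(1) closed_nbhd_Un B_def by blast
    then show "S \<in> ?L" using T CV by (auto simp: B_def)
  qed
  moreover have "inj_on ((\<union>) B) Q"
    by (auto simp: inj_on_def Q_def B_def)
  moreover have "card (B \<union> T) = card B + card T" if "T \<in> Q" for T
    using that fin finite_subset[of T hood] by (intro card_Un_disjoint) (auto simp: Q_def B_def)
  ultimately have "size_enum {S. S \<subseteq> ?V \<and> ?V \<subseteq> hood \<union> S \<and> ?V \<subseteq> closed_nbhd G S \<union> W}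
      = ratfun_X ^ card B * size_enum Q"
    by (simp add: size_enum_def sum.reindex power_add sum_distrib_left)
  moreover have "card ?V = card W + card B + card (open_nbhd G W)"
  proof -
    have "card (open_nbhd G W) = card hood - card W" "card B = card ?V - card hood"
      using WC CV fin by (simp_all add: open_nbhd_def B_def card_Diff_subset)
    then show ?thesis
      using card_mono[OF fin(1) WC] card_mono[OF finite_verts CV] by simp
  qed
  moreover have "size_enum {T. T \<subseteq> verts ?J - {None} \<and>
       verts ?J - closed_nbhd ?J {None} \<subseteq> closed_nbhd ?J T} = size_enum Q"
  proof -
    have "verts ?J - closed_nbhd ?J {None} = Some ` (hood - joined)"
      by (auto simp: verts_J_graph closed_nbhd_def[of ?J] dominates_J_graph)
    moreover have "Some ` (hood - joined) \<subseteq> closed_nbhd ?J (Some ` T) \<longleftrightarrow> hood - joined \<subseteq> closed_nbhd G T"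
      if "T \<subseteq> hood" for T
    proof -
      have "Some v \<in> closed_nbhd ?J (Some ` T) \<longleftrightarrow> v \<in> closed_nbhd G T" if "v \<in> hood" for v
        using that \<open>T \<subseteq> hood\<close>
        by (auto simp: closed_nbhd_def[of ?J] closed_nbhd_def[of G T] dominates_J_graph)
      then show ?thesis by blast
    qed
    moreover have "verts ?J - {None} = Some ` hood"
      by (auto simp: verts_J_graph)
    ultimately have "{T. T \<subseteq> verts ?J - {None} \<and>
       verts ?J - closed_nbhd ?J {None} \<subseteq> closed_nbhd ?J T} = (`) Some ` Q"
      by (auto simp: Q_def subset_image_iff)
    moreover have "inj_on ((`) Some) Q"
      by (auto simp: inj_on_def inj_image_eq_iff)
    ultimately show ?thesis
      by (simp add: size_enum_def sum.reindex card_image)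
  qed
  moreover have "ratfun_X \<noteq> 0"
    by (simp add: ratfun_X_def)
  ultimately show ?thesis
    by (simp add: power_add)
qed

end

theorem theorem2p1:
  fixes G :: "('a,'b) pre_digraph" and K2 :: "('c,'d) pre_digraph"
  assumes "graph G" and "verts G \<noteq> {}" and "K\<^bsub>2\<^esub> K2"
  shows "domination_ratfun (cartesian_product G K2) =
    ratfun_X ^ card (verts G) / (ratfun_X + 1) *
    (\<Sum>W\<in>Pow (verts G).
      (domination_ratfun (contract_vert (J_graph G W) None)
       + domination_ratfun (delete_verts (J_graph G W) (closed_nbhd (J_graph G W) {None}))
       + domination_ratfun (J_graph G W)
       - domination_ratfun (delete_verts (J_graph G W) {None}))
      / ratfun_X ^ card (open_nbhd G W))"
proof -
  interpret graph G by fact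
  have "[:0, 1:] + 1 \<noteq> (0 :: int poly)" by (simp add: one_pCons)
  then have X1: "ratfun_X + 1 \<noteq> 0"
    unfolding ratfun_X_def by (metis to_fract_1 to_fract_add to_fract_eq_0_iff)
  show ?thesis
    unfolding domination_ratfun_prism[OF finite_verts \<open>K\<^bsub>2\<^esub> K2\<close>] sum_distrib_left
  proof (rule sum.cong)
    fix W assume "W \<in> Pow (verts G)"
    then have W: "W \<subseteq> verts G" by simp
    let ?J = "J_graph G W"
    have z: "None \<in> verts ?J" by (simp add: verts_J_graph[OF \<open>graph G\<close> W])
    show "ratfun_X ^ card W * size_enum {S. S \<subseteq> verts G \<and> verts G \<subseteq> closed_nbhd G W \<union> S
          \<and> verts G \<subseteq> closed_nbhd G S \<union> W} =
      ratfun_X ^ card (verts G) / (ratfun_X + 1) *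
      ((domination_ratfun (contract_vert ?J None)
       + domination_ratfun (delete_verts ?J (closed_nbhd ?J {None}))
       + domination_ratfun ?J
       - domination_ratfun (delete_verts ?J {None})) / ratfun_X ^ card (open_nbhd G W))"
      unfolding size_enum_second_layer[OF \<open>graph G\<close> W]
        size_enum_dominating_far_verts[OF pseudo_graph_J_graph[OF \<open>graph G\<close> W] z, symmetric]
      using X1 by simp
  qed simp
qed

end
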